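(* Let $\rho>0$, let $H$ be regularly varying at $0$ with index $-\rho$, let $A,B$ be nonnegative random variables, suppose that $B$ is an $\mathrm{IED}^\rho_H(\gamma)$-random variable and that $A$ and $B$ are positively quadrant dependent. Let $$a=\mathrm{ess\,inf}(A)=\sup\{x\in\mathbb{R}:\mathbb{P}(A<x)=0\}.$$ Then the $(\rho,H)$-local dependence measure $g$ of $(A,B)$ is $$g(y)=\begin{cases}\gamma(1-ay)^{-\rho}, & y\in[0,1/a),\\ \infty, & y\ge 1/a,\end{cases}$$ where $1/a=\infty$ if $a=0$.
   Context: A function $H:(0,\infty)\to(0,\infty)$ is regularly varying at $0$ with index $-\rho$ if $\lim_{x\to0^+}H(tx)/H(x)=t^{-\rho}$ for all $t>0$; by convention every such $H$ is taken continuous and nonincreasing. A nonnegative random variable $X$ is an $\mathrm{IED}^\rho_H(\gamma)$-random variable, where $\gamma\in[0,\infty]$, if $\lim_{x\to 0^+}\frac{-\log \mathbb{P}(X<x)}{H(x)}=\gamma$. A function $g:[0,\infty)\to[0,\infty]$ is the $(\rho,H)$-local dependence measure of a pair $(A,B)$ of nonnegative random variables if for every $y\ge 0$ the following limit exists and $$g(y)=\lim_{\varepsilon\to0^+}\frac{-\log\mathbb{P}(\varepsilon Ay+B<\varepsilon)}{H(\varepsilon)}.$$ Convention: $-\log 0=\infty$. Random variables $A$ and $B$ are positively quadrant dependent if $\mathbb{P}(A>s,B>t)\ge\mathbb{P}(A>s)\mathbb{P}(B>t)$ for all $s,t\in\mathbb{R}$. *)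

theory Defs
  imports "HOL-Probability.Probability"
begin

text \<open>The standing convention that regularly varying functions are continuous and
  nonincreasing is part of the predicate. Only the values of \<open>H\<close> on \<open>(0,\<infinity>)\<close> are relevant.\<close>

definition regularly_varying_at_0 :: "real \<Rightarrow> (real \<Rightarrow> real) \<Rightarrow> bool" where
  "regularly_varying_at_0 \<alpha> H \<longleftrightarrow>
     (\<forall>x>0. H x > 0) \<and>
     continuous_on {0<..} H \<and>
     antimono_on {0<..} H \<and>
     (\<forall>t>0. ((\<lambda>x. H (t * x) / H x) \<longlongrightarrow> t powr \<alpha>) (at_right 0))"

text \<open>The negative logarithm of a probability, with \<open>-log 0 = \<infinity>\<close>
  (whereas \<open>ln 0 = 0\<close> in the library).\<close>

definition neg_log :: "real \<Rightarrow> ereal" where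
  "neg_log p = (if p = 0 then \<infinity> else ereal (- ln p))"

definition nonneg_rv :: "'a measure \<Rightarrow> ('a \<Rightarrow> real) \<Rightarrow> bool" where
  "nonneg_rv M X \<longleftrightarrow> X \<in> borel_measurable M \<and> (AE \<omega> in M. 0 \<le> X \<omega>)"

definition IED ::
  "'a measure \<Rightarrow> real \<Rightarrow> (real \<Rightarrow> real) \<Rightarrow> ereal \<Rightarrow> ('a \<Rightarrow> real) \<Rightarrow> bool" where
  "IED M \<rho> H \<gamma> X \<longleftrightarrow>
     regularly_varying_at_0 (- \<rho>) H \<and> nonneg_rv M X \<and> 0 \<le> \<gamma> \<and>
     ((\<lambda>x. neg_log (\<P>(\<omega> in M. X \<omega> < x)) / ereal (H x)) \<longlongrightarrow> \<gamma>) (at_right 0)"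

text \<open>A function \<open>[0,\<infinity>) \<rightarrow> [0,\<infinity>]\<close> is represented by \<open>g :: real \<Rightarrow> ereal\<close>, constrained only
  at \<open>y \<ge> 0\<close>.\<close>

definition local_dependence_measure ::
  "'a measure \<Rightarrow> real \<Rightarrow> (real \<Rightarrow> real) \<Rightarrow> ('a \<Rightarrow> real) \<Rightarrow> ('a \<Rightarrow> real) \<Rightarrow> (real \<Rightarrow> ereal) \<Rightarrow> bool" where
  "local_dependence_measure M \<rho> H A B g \<longleftrightarrow>
     regularly_varying_at_0 (- \<rho>) H \<and> nonneg_rv M A \<and> nonneg_rv M B \<and>
     (\<forall>y\<ge>0. 0 \<le> g y \<and>
        ((\<lambda>\<epsilon>. neg_log (\<P>(\<omega> in M. \<epsilon> * A \<omega> * y + B \<omega> < \<epsilon>)) / ereal (H \<epsilon>)) \<longlongrightarrow> g y) (at_right 0))"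

definition positively_quadrant_dependent ::
  "'a measure \<Rightarrow> ('a \<Rightarrow> real) \<Rightarrow> ('a \<Rightarrow> real) \<Rightarrow> bool" where
  "positively_quadrant_dependent M A B \<longleftrightarrow>
     (\<forall>s t. \<P>(\<omega> in M. A \<omega> > s \<and> B \<omega> > t) \<ge> \<P>(\<omega> in M. A \<omega> > s) * \<P>(\<omega> in M. B \<omega> > t))"

text \<open>For a nonnegative real random variable the set below is nonempty and bounded above,
  so its supremum in the reals is the genuine one.\<close>

definition ess_inf :: "'a measure \<Rightarrow> ('a \<Rightarrow> real) \<Rightarrow> real" where
  "ess_inf M X = Sup {x. \<P>(\<omega> in M. X \<omega> < x) = 0}"

end

theory Submission
  imports Defs
begin

text \<open>
  The exponent of \<open>P(\<epsilon>Ay + B < \<epsilon>)\<close> depends on \<open>A\<close> only through its essential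
  infimum \<open>a\<close>. Almost surely \<open>A \<ge> a\<close>, so the event forces \<open>B < \<epsilon>(1 - ay)\<close>; this is
  impossible when \<open>ay \<ge> 1\<close>, and otherwise it bounds the exponent from below by that of
  \<open>P(B < \<epsilon>(1 - ay))\<close>, which regular variation evaluates to \<open>\<gamma>(1 - ay)\<^sup>-\<^sup>\<rho>\<close>
  (\<open>IED_scaled\<close>).

  For the opposite bound let \<open>0 < c < 1 - ay\<close>. Some \<open>s > a\<close> still satisfies \<open>sy + c < 1\<close>, so
  the event contains \<open>A \<le> s, B \<le> c\<epsilon>\<close>. Positive quadrant dependence, passed to the lower
  quadrant, bounds the probability of the latter below by \<open>P(A \<le> s) P(B \<le> c\<epsilon>)\<close>. The first
  factor is positive and does not depend on \<open>\<epsilon>\<close>; since \<open>H\<close> blows up at \<open>0\<close>, it disappears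
  after division by \<open>H \<epsilon>\<close>. Thus the upper limit is at most \<open>\<gamma> c\<^sup>-\<^sup>\<rho>\<close>, and
  \<open>c \<rightarrow> 1 - ay\<close> closes the gap.
\<close>

section \<open>Negative logarithms\<close>

lemma neg_log_antimono:
  assumes "0 \<le> p" "p \<le> q"
  shows "neg_log q \<le> neg_log p"
  using assms by (auto simp: neg_log_def)

lemma neg_log_mult:
  assumes "0 < p" "0 \<le> q"
  shows "neg_log (p * q) = neg_log p + neg_log q"
  using assms by (auto simp: neg_log_def ln_mult)

section \<open>Regular variation at zero\<close>

text \<open>A nonincreasing function that stays bounded near \<open>0\<close> has a finite positive limit there,
  so its ratios \<open>H (x / 2) / H x\<close> tend to \<open>1\<close> and not to \<open>2 powr \<rho>\<close>.\<close>

lemma regularly_varying_at_0_at_top: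
  assumes rv: "regularly_varying_at_0 (- \<rho>) H" and "\<rho> > 0"
  shows "filterlim H at_top (at_right 0)"
proof -
  have pos: "\<And>x. 0 < x \<Longrightarrow> 0 < H x"
    and anti: "\<And>x y. 0 < x \<Longrightarrow> x \<le> y \<Longrightarrow> H y \<le> H x"
    and ratio: "\<forall>t>0. ((\<lambda>x. H (t * x) / H x) \<longlongrightarrow> t powr (- \<rho>)) (at_right 0)"
    using rv by (auto simp: regularly_varying_at_0_def monotone_on_def)
  have lim: "((\<lambda>x. H ((1/2) * x) / H x) \<longlongrightarrow> (1/2) powr (- \<rho>)) (at_right 0)"
    using ratio[rule_format, of "1/2"] by simp
  have unbounded: "\<exists>x>0. H x > K" for K
  proof (rule ccontr)
    assume "\<not> (\<exists>x>0. H x > K)"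
    then have bdd: "bdd_above (H ` {0<..})"
      by (intro bdd_aboveI[of _ K]) force
    define L where "L = Sup (H ` {0<..})"
    have le: "H x \<le> L" if "0 < x" for x
      unfolding L_def by (rule cSup_upper) (use that bdd in auto)
    have "L > 0" using le[of 1] pos[of 1] by simp
    have H_lim: "(H \<longlongrightarrow> L) (at_right 0)"
    proof (rule order_tendstoI)
      fix l assume "l < L"
      then obtain x where x: "0 < x" "l < H x"
        unfolding L_def by (subst (asm) less_cSup_iff) (use bdd in auto)
      have "eventually (\<lambda>z. z \<in> {0<..<x}) (at_right 0)"
        using x(1) by (intro eventually_at_right_real) auto
      then show "eventually (\<lambda>z. l < H z) (at_right 0)"
        by eventually_elim (use anti x in \<open>smt (verit) greaterThanLessThan_iff\<close>)
    next
      fix u assume "L < u"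
      then show "eventually (\<lambda>z. H z < u) (at_right 0)"
        using eventually_at_right_less[of "0::real"]
        by (auto elim!: eventually_mono dest: le)
    qed
    have "filterlim (\<lambda>x::real. (1/2) * x) (at_right 0) (at_right 0)"
      by (rule filterlim_times_pos[OF filterlim_ident]) auto
    then have "((\<lambda>x. H ((1/2) * x)) \<longlongrightarrow> L) (at_right 0)"
      by (rule filterlim_compose[OF H_lim])
    then have "((\<lambda>x. H ((1/2) * x) / H x) \<longlongrightarrow> L / L) (at_right 0)"
      using H_lim \<open>L > 0\<close> by (intro tendsto_divide) auto
    with lim have "(1/2) powr (- \<rho>) = L / L"
      by (intro tendsto_unique[of "at_right (0::real)"]) auto
    moreover have "(1/2::real) powr (- \<rho>) > 1"
      using \<open>\<rho> > 0\<close> by (simp add: powr_def ln_div mult_less_0_iff)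
    ultimately show False using \<open>L > 0\<close> by simp
  qed
  show ?thesis
    unfolding filterlim_at_top_dense
  proof
    fix K
    obtain x where x: "0 < x" "K < H x" using unbounded by blast
    have "eventually (\<lambda>z. z \<in> {0<..<x}) (at_right 0)"
      using x(1) by (intro eventually_at_right_real) auto
    then show "eventually (\<lambda>z. K < H z) (at_right 0)"
      by eventually_elim (use anti x in \<open>smt (verit) greaterThanLessThan_iff\<close>)
  qed
qed

text \<open>Regular variation converts a rescaling of the threshold into a factor of the exponent.\<close>

lemma IED_scaled:
  assumes ied: "IED M \<rho> H \<gamma> X" and "c > 0"
  shows "((\<lambda>\<epsilon>. neg_log (\<P>(\<omega> in M. X \<omega> < c * \<epsilon>)) / ereal (H \<epsilon>))
           \<longlongrightarrow> \<gamma> * ereal (c powr (- \<rho>))) (at_right 0)"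
proof -
  let ?f = "\<lambda>x. neg_log (\<P>(\<omega> in M. X \<omega> < x)) / ereal (H x)"
  have f: "(?f \<longlongrightarrow> \<gamma>) (at_right 0)"
    and pos: "\<And>x. 0 < x \<Longrightarrow> 0 < H x"
    and ratio: "((\<lambda>x. H (c * x) / H x) \<longlongrightarrow> c powr (- \<rho>)) (at_right 0)"
    using ied \<open>c > 0\<close> by (auto simp: IED_def regularly_varying_at_0_def)
  have "filterlim (\<lambda>x. c * x) (at_right 0) (at_right 0)"
    by (rule filterlim_times_pos[OF filterlim_ident]) (use \<open>c > 0\<close> in auto)
  then have "((\<lambda>\<epsilon>. ?f (c * \<epsilon>)) \<longlongrightarrow> \<gamma>) (at_right 0)"
    by (rule filterlim_compose[OF f])
  moreover have "((\<lambda>x. ereal (H (c * x) / H x)) \<longlongrightarrow> ereal (c powr (- \<rho>))) (at_right 0)"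
    using ratio by simp
  ultimately have "((\<lambda>\<epsilon>. ?f (c * \<epsilon>) * ereal (H (c * \<epsilon>) / H \<epsilon>))
                     \<longlongrightarrow> \<gamma> * ereal (c powr (- \<rho>))) (at_right 0)"
    using \<open>c > 0\<close> by (intro tendsto_mult_ereal) auto
  moreover have "eventually (\<lambda>\<epsilon>. ?f (c * \<epsilon>) * ereal (H (c * \<epsilon>) / H \<epsilon>)
      = neg_log (\<P>(\<omega> in M. X \<omega> < c * \<epsilon>)) / ereal (H \<epsilon>)) (at_right 0)"
    using eventually_at_right_less[of "0::real"]
  proof eventually_elim
    case (elim \<epsilon>)
    then have "0 < H (c * \<epsilon>)" "0 < H \<epsilon>" using pos \<open>c > 0\<close> by auto
    then show ?case by (auto simp: neg_log_def)
  qed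
  ultimately show ?thesis by (rule Lim_transform_eventually)
qed

section \<open>Essential infimum and quadrant dependence\<close>

context prob_space
begin

text \<open>The set in the definition of \<^const>\<open>ess_inf\<close> is bounded because \<open>P(X < n) \<rightarrow> 1\<close>.\<close>

lemma bdd_above_ess_inf_set:
  fixes X :: "'a \<Rightarrow> real"
  assumes [measurable]: "X \<in> borel_measurable M"
  shows "bdd_above {x. \<P>(\<omega> in M. X \<omega> < x) = 0}"
proof -
  have un: "(\<Union>n::nat. {\<omega> \<in> space M. X \<omega> < real n}) = space M"
    using reals_Archimedean2 by auto
  have "(\<lambda>n::nat. \<P>(\<omega> in M. X \<omega> < real n)) \<longlonglongrightarrow> prob (\<Union>n::nat. {\<omega> \<in> space M. X \<omega> < real n})"
    by (rule finite_Lim_measure_incseq) (auto simp: incseq_def)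
  then have "(\<lambda>n::nat. \<P>(\<omega> in M. X \<omega> < real n)) \<longlonglongrightarrow> 1"
    by (simp add: un prob_space)
  then have "eventually (\<lambda>n::nat. 0 < \<P>(\<omega> in M. X \<omega> < real n)) sequentially"
    by (rule order_tendstoD) simp
  then obtain n :: nat where n: "0 < \<P>(\<omega> in M. X \<omega> < real n)"
    by (auto simp: eventually_sequentially)
  show ?thesis
  proof (rule bdd_aboveI[of _ "real n"])
    fix x assume x: "x \<in> {x. \<P>(\<omega> in M. X \<omega> < x) = 0}"
    show "x \<le> real n"
    proof (rule ccontr)
      assume "\<not> x \<le> real n"
      then have "\<P>(\<omega> in M. X \<omega> < real n) \<le> \<P>(\<omega> in M. X \<omega> < x)"
        by (intro finite_measure_mono) auto
      with x n show False by simp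
    qed
  qed
qed

lemma prob_less_pos_if_ess_inf_less:
  assumes "X \<in> borel_measurable M" and "ess_inf M X < s"
  shows "0 < \<P>(\<omega> in M. X \<omega> < s)"
proof (rule ccontr)
  assume "\<not> 0 < \<P>(\<omega> in M. X \<omega> < s)"
  then have "s \<in> {x. \<P>(\<omega> in M. X \<omega> < x) = 0}"
    by (simp add: not_less antisym[OF _ measure_nonneg])
  then have "s \<le> ess_inf M X"
    unfolding ess_inf_def using bdd_above_ess_inf_set[OF assms(1)] by (rule cSup_upper)
  with assms(2) show False by simp
qed

lemma prob_less_eq_0_iff_AE:
  fixes X :: "'a \<Rightarrow> real"
  assumes [measurable]: "X \<in> borel_measurable M"
  shows "\<P>(\<omega> in M. X \<omega> < x) = 0 \<longleftrightarrow> (AE \<omega> in M. x \<le> X \<omega>)"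
  by (subst prob_eq_0) (auto simp: not_less)

lemma nonneg_rv_ess_inf:
  assumes "nonneg_rv M X"
  shows ess_inf_nonneg: "0 \<le> ess_inf M X"
    and AE_ess_inf_le: "AE \<omega> in M. ess_inf M X \<le> X \<omega>"
proof -
  have X[measurable]: "X \<in> borel_measurable M" and "AE \<omega> in M. 0 \<le> X \<omega>"
    using assms by (auto simp: nonneg_rv_def)
  then have zero: "0 \<in> {x. \<P>(\<omega> in M. X \<omega> < x) = 0}"
    by (simp add: prob_less_eq_0_iff_AE)
  then show "0 \<le> ess_inf M X"
    unfolding ess_inf_def using bdd_above_ess_inf_set[OF X] by (rule cSup_upper)
  \<comment> \<open>Countably many lower bounds increasing to the essential infimum hold simultaneously.\<close>
  have "AE \<omega> in M. ess_inf M X - 1 / Suc n \<le> X \<omega>" for n :: nat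
  proof -
    have "ess_inf M X - 1 / Suc n < ess_inf M X" by simp
    then obtain z where z: "\<P>(\<omega> in M. X \<omega> < z) = 0" "ess_inf M X - 1 / Suc n < z"
      using less_cSupD[of "{x. \<P>(\<omega> in M. X \<omega> < x) = 0}"] zero
      unfolding ess_inf_def by blast
    from z(1) have "AE \<omega> in M. z \<le> X \<omega>" by (simp add: prob_less_eq_0_iff_AE)
    then show ?thesis by eventually_elim (use z(2) in auto)
  qed
  then have "AE \<omega> in M. \<forall>n::nat. ess_inf M X - 1 / Suc n \<le> X \<omega>"
    by (simp add: AE_all_countable)
  then show "AE \<omega> in M. ess_inf M X \<le> X \<omega>"
  proof eventually_elim
    case (elim \<omega>)
    show ?case
    proof (rule ccontr)
      assume "\<not> ess_inf M X \<le> X \<omega>"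
      then obtain n :: nat where "1 / Suc n < ess_inf M X - X \<omega>"
        using nat_approx_posE[of "ess_inf M X - X \<omega>"] by auto
      then show False using elim[rule_format, of n] by linarith
    qed
  qed
qed

text \<open>Positive quadrant dependence is symmetric under passing to complements: by inclusion and
  exclusion, \<open>P(A \<le> s, B \<le> t) - P(A \<le> s) P(B \<le> t) = P(A > s, B > t) - P(A > s) P(B > t)\<close>.\<close>

lemma positively_quadrant_dependent_lower:
  fixes A B :: "'a \<Rightarrow> real"
  assumes pqd: "positively_quadrant_dependent M A B"
    and [measurable]: "A \<in> borel_measurable M" "B \<in> borel_measurable M"
  shows "\<P>(\<omega> in M. A \<omega> \<le> s) * \<P>(\<omega> in M. B \<omega> \<le> t) \<le> \<P>(\<omega> in M. A \<omega> \<le> s \<and> B \<omega> \<le> t)"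
proof -
  let ?S = "{\<omega> \<in> space M. A \<omega> > s}" and ?T = "{\<omega> \<in> space M. B \<omega> > t}"
  have [measurable]: "?S \<in> sets M" "?T \<in> sets M" by measurable
  have compl: "{\<omega> \<in> space M. A \<omega> \<le> s} = space M - ?S" "{\<omega> \<in> space M. B \<omega> \<le> t} = space M - ?T"
    "{\<omega> \<in> space M. A \<omega> \<le> s \<and> B \<omega> \<le> t} = space M - (?S \<union> ?T)"
    "{\<omega> \<in> space M. A \<omega> > s \<and> B \<omega> > t} = ?S \<inter> ?T" by auto
  have "prob ?S * prob ?T \<le> prob (?S \<inter> ?T)"
    using pqd unfolding positively_quadrant_dependent_def compl(4)[symmetric] by blast
  moreover have "prob (?S \<union> ?T) = prob ?S + prob ?T - prob (?S \<inter> ?T)"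
    by (rule measure_Un3) (auto simp: fmeasurable_eq_sets)
  ultimately show ?thesis
    unfolding compl(1-3) by (simp add: prob_compl algebra_simps)
qed

section \<open>The local dependence measure\<close>

text \<open>The limit is squeezed. The lower half uses only \<open>A \<ge> a\<close> almost surely and would hold
  for any dependence of \<open>A\<close> and \<open>B\<close>; positive quadrant dependence is what makes small values of
  \<open>A\<close> and of \<open>B\<close> occur together often enough for the upper half.\<close>

lemma local_dependence_limit_subcritical:
  assumes "\<rho> > 0" and A: "nonneg_rv M A" and ied: "IED M \<rho> H \<gamma> B"
    and pqd: "positively_quadrant_dependent M A B"
    and "0 \<le> y" and sub: "ess_inf M A * y < 1"
  shows "((\<lambda>\<epsilon>. neg_log (\<P>(\<omega> in M. \<epsilon> * A \<omega> * y + B \<omega> < \<epsilon>)) / ereal (H \<epsilon>))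
           \<longlongrightarrow> \<gamma> * ereal ((1 - ess_inf M A * y) powr (- \<rho>))) (at_right 0)"
    (is "(?F \<longlongrightarrow> \<gamma> * ereal (?d powr _)) _")
proof (rule order_tendstoI)
  let ?a = "ess_inf M A"
  have [measurable]: "A \<in> borel_measurable M" "B \<in> borel_measurable M"
    and rv: "regularly_varying_at_0 (- \<rho>) H" and "0 \<le> \<gamma>"
    and pos: "\<And>x. 0 < x \<Longrightarrow> 0 < H x"
    using A ied by (auto simp: nonneg_rv_def IED_def regularly_varying_at_0_def)
  {
    fix l assume "l < \<gamma> * ereal (?d powr (- \<rho>))"
    then have "eventually (\<lambda>\<epsilon>. l < neg_log (\<P>(\<omega> in M. B \<omega> < ?d * \<epsilon>)) / ereal (H \<epsilon>)) (at_right 0)"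
      using IED_scaled[OF ied, of ?d] sub by (intro order_tendstoD) auto
    then show "eventually (\<lambda>\<epsilon>. l < ?F \<epsilon>) (at_right 0)"
      using eventually_at_right_less[of "0::real"]
    proof eventually_elim
      case (elim \<epsilon>)
      have "AE \<omega> in M. \<epsilon> * A \<omega> * y + B \<omega> < \<epsilon> \<longrightarrow> B \<omega> < ?d * \<epsilon>"
        using AE_ess_inf_le[OF A]
      proof eventually_elim
        case (elim \<omega>)
        then have "?a * (y * \<epsilon>) \<le> A \<omega> * (y * \<epsilon>)"
          using \<open>0 \<le> y\<close> \<open>0 < \<epsilon>\<close> by (intro mult_right_mono) auto
        then show ?case by (auto simp: algebra_simps)
      qed
      then have "\<P>(\<omega> in M. \<epsilon> * A \<omega> * y + B \<omega> < \<epsilon>) \<le> \<P>(\<omega> in M. B \<omega> < ?d * \<epsilon>)"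
        by (intro finite_measure_mono_AE) auto
      then have "neg_log (\<P>(\<omega> in M. B \<omega> < ?d * \<epsilon>)) / ereal (H \<epsilon>) \<le> ?F \<epsilon>"
        using pos[OF \<open>0 < \<epsilon>\<close>] by (intro ereal_divide_right_mono neg_log_antimono) auto
      with elim(1) show ?case by (rule less_le_trans)
    qed
  next
    fix u assume u: "\<gamma> * ereal (?d powr (- \<rho>)) < u"
    \<comment> \<open>An upper bound has to be checked only for finite \<open>\<gamma>\<close>, where the limit is continuous in the
      scale \<open>c\<close>; hence some scale below \<open>1 - ay\<close> already gives a value below \<open>u\<close>.\<close>
    have "0 < ?d" using sub by simp
    then obtain r where r: "\<gamma> = ereal r"
      using u \<open>0 \<le> \<gamma>\<close> by (cases \<gamma>) auto
    have "((\<lambda>c. ereal (r * c powr (- \<rho>))) \<longlongrightarrow> ereal (r * ?d powr (- \<rho>))) (at_left ?d)"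
      using \<open>0 < ?d\<close> by (intro tendsto_intros) auto
    then have "eventually (\<lambda>c. ereal (r * c powr (- \<rho>)) < u) (at_left ?d)"
      using u r by (intro order_tendstoD) auto
    moreover have "eventually (\<lambda>c. c \<in> {0<..<?d}) (at_left ?d)"
      using \<open>0 < ?d\<close> by (rule eventually_at_left_real)
    ultimately have "eventually (\<lambda>c. ereal (r * c powr (- \<rho>)) < u \<and> c \<in> {0<..<?d}) (at_left ?d)"
      by (rule eventually_conj)
    then obtain c where c: "\<gamma> * ereal (c powr (- \<rho>)) < u" "0 < c" "c < ?d"
      using eventually_happens'[of "at_left ?d"] r by auto
    \<comment> \<open>The slack between \<open>c\<close> and \<open>1 - ay\<close> makes room for an \<open>s\<close> above the essential infimum.\<close>
    have "((\<lambda>s. s * y + c) \<longlongrightarrow> ?a * y + c) (at_right ?a)"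
      by (intro tendsto_intros)
    then have "eventually (\<lambda>s. s * y + c < 1) (at_right ?a)"
      using c(3) by (intro order_tendstoD) auto
    then have "eventually (\<lambda>s. s * y + c < 1 \<and> ?a < s) (at_right ?a)"
      using eventually_at_right_less by (rule eventually_conj)
    then obtain s where s: "s * y + c < 1" "?a < s"
      using eventually_happens'[of "at_right ?a"] by auto
    define p where "p = \<P>(\<omega> in M. A \<omega> \<le> s)"
    have "0 < \<P>(\<omega> in M. A \<omega> < s)"
      using s(2) by (intro prob_less_pos_if_ess_inf_less) auto
    also have "\<dots> \<le> p"
      unfolding p_def by (intro finite_measure_mono) auto
    finally have "0 < p" .
    \<comment> \<open>The factor \<open>p\<close> costs an additive constant, which is negligible against \<open>H\<close>.\<close>
    have "((\<lambda>\<epsilon>. - ln p / H \<epsilon>) \<longlongrightarrow> 0) (at_right 0)"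
      using regularly_varying_at_0_at_top[OF rv \<open>\<rho> > 0\<close>]
      by (intro real_tendsto_divide_at_top[OF tendsto_const])
    then have "((\<lambda>\<epsilon>. ereal (- ln p / H \<epsilon>)) \<longlongrightarrow> ereal 0) (at_right 0)"
      by (rule tendsto_ereal)
    moreover have "((\<lambda>\<epsilon>. neg_log (\<P>(\<omega> in M. B \<omega> < c * \<epsilon>)) / ereal (H \<epsilon>))
        \<longlongrightarrow> \<gamma> * ereal (c powr (- \<rho>))) (at_right 0)"
      by (rule IED_scaled[OF ied c(2)])
    ultimately have "((\<lambda>\<epsilon>. ereal (- ln p / H \<epsilon>) + neg_log (\<P>(\<omega> in M. B \<omega> < c * \<epsilon>)) / ereal (H \<epsilon>))
        \<longlongrightarrow> ereal 0 + \<gamma> * ereal (c powr (- \<rho>))) (at_right 0)"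
      by (intro tendsto_add_ereal_general) (auto simp: r)
    then have "eventually (\<lambda>\<epsilon>. ereal (- ln p / H \<epsilon>)
        + neg_log (\<P>(\<omega> in M. B \<omega> < c * \<epsilon>)) / ereal (H \<epsilon>) < u) (at_right 0)"
      using c(1) by (intro order_tendstoD) (auto simp: zero_ereal_def[symmetric])
    then show "eventually (\<lambda>\<epsilon>. ?F \<epsilon> < u) (at_right 0)"
      using eventually_at_right_less[of "0::real"]
    proof eventually_elim
      case (elim \<epsilon>)
      let ?q = "\<P>(\<omega> in M. B \<omega> < c * \<epsilon>)"
      have "p * ?q \<le> p * \<P>(\<omega> in M. B \<omega> \<le> c * \<epsilon>)"
        using \<open>0 < p\<close> by (intro mult_left_mono finite_measure_mono) auto
      also have "\<dots> \<le> \<P>(\<omega> in M. A \<omega> \<le> s \<and> B \<omega> \<le> c * \<epsilon>)"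
        unfolding p_def by (rule positively_quadrant_dependent_lower[OF pqd]) auto
      also have "\<dots> \<le> \<P>(\<omega> in M. \<epsilon> * A \<omega> * y + B \<omega> < \<epsilon>)"
      proof (rule finite_measure_mono)
        show "{\<omega> \<in> space M. A \<omega> \<le> s \<and> B \<omega> \<le> c * \<epsilon>}
            \<subseteq> {\<omega> \<in> space M. \<epsilon> * A \<omega> * y + B \<omega> < \<epsilon>}"
        proof safe
          fix \<omega> assume \<omega>: "A \<omega> \<le> s" "B \<omega> \<le> c * \<epsilon>"
          have "A \<omega> * (\<epsilon> * y) \<le> s * (\<epsilon> * y)"
            using \<omega>(1) \<open>0 \<le> y\<close> \<open>0 < \<epsilon>\<close> by (intro mult_right_mono) auto
          moreover have "(s * y + c) * \<epsilon> < 1 * \<epsilon>"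
            using s(1) \<open>0 < \<epsilon>\<close> by (intro mult_strict_right_mono)
          ultimately show "\<epsilon> * A \<omega> * y + B \<omega> < \<epsilon>"
            using \<omega>(2) by (simp add: algebra_simps)
        qed
      qed auto
      finally have "neg_log (\<P>(\<omega> in M. \<epsilon> * A \<omega> * y + B \<omega> < \<epsilon>)) \<le> neg_log (p * ?q)"
        using \<open>0 < p\<close> by (intro neg_log_antimono) auto
      then have "?F \<epsilon> \<le> neg_log (p * ?q) / ereal (H \<epsilon>)"
        using pos[OF \<open>0 < \<epsilon>\<close>] by (intro ereal_divide_right_mono) auto
      also have "\<dots> = (neg_log p + neg_log ?q) / ereal (H \<epsilon>)"
        using \<open>0 < p\<close> by (simp add: neg_log_mult)
      also have "\<dots> = ereal (- ln p / H \<epsilon>) + neg_log ?q / ereal (H \<epsilon>)"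
        using \<open>0 < p\<close> pos[OF \<open>0 < \<epsilon>\<close>] by (auto simp: neg_log_def diff_divide_distrib)
      finally show ?case using elim(1) by (rule le_less_trans)
    qed
  }
qed

lemma local_dependence_limit_supercritical:
  assumes A: "nonneg_rv M A" and B: "nonneg_rv M B"
    and rv: "regularly_varying_at_0 (- \<rho>) H"
    and "0 \<le> y" and super: "1 \<le> ess_inf M A * y"
  shows "((\<lambda>\<epsilon>. neg_log (\<P>(\<omega> in M. \<epsilon> * A \<omega> * y + B \<omega> < \<epsilon>)) / ereal (H \<epsilon>)) \<longlongrightarrow> \<infinity>) (at_right 0)"
proof -
  have [measurable]: "A \<in> borel_measurable M" "B \<in> borel_measurable M"
    and B0: "AE \<omega> in M. 0 \<le> B \<omega>" and pos: "\<And>x. 0 < x \<Longrightarrow> 0 < H x"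
    using A B rv by (auto simp: nonneg_rv_def regularly_varying_at_0_def)
  have "eventually (\<lambda>\<epsilon>. \<infinity> = neg_log (\<P>(\<omega> in M. \<epsilon> * A \<omega> * y + B \<omega> < \<epsilon>)) / ereal (H \<epsilon>))
      (at_right 0)"
    using eventually_at_right_less[of "0::real"]
  proof eventually_elim
    case (elim \<epsilon>)
    have "AE \<omega> in M. \<epsilon> \<le> \<epsilon> * A \<omega> * y + B \<omega>"
      using AE_ess_inf_le[OF A] B0
    proof eventually_elim
      case (elim \<omega>)
      have "1 \<le> A \<omega> * y"
        using super mult_right_mono[OF elim(1) \<open>0 \<le> y\<close>] by linarith
      then have "\<epsilon> * 1 \<le> \<epsilon> * (A \<omega> * y)"
        using \<open>0 < \<epsilon>\<close> by (intro mult_left_mono) auto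
      then show ?case using elim(2) by (simp add: mult.assoc)
    qed
    then have "\<P>(\<omega> in M. \<epsilon> * A \<omega> * y + B \<omega> < \<epsilon>) = 0"
      by (subst prob_eq_0) (auto simp: not_less)
    then show ?case using pos[OF elim] by (simp add: neg_log_def)
  qed
  then show ?thesis by (rule Lim_transform_eventually[OF tendsto_const])
qed

end

lemma ereal_less_inverse_iff:
  assumes "0 \<le> a"
  shows "ereal y < 1 / ereal a \<longleftrightarrow> a * y < 1"
proof (cases "a = 0")
  case False
  then have "1 / ereal a = ereal (1 / a)" by (simp add: one_ereal_def)
  then show ?thesis using False assms by (simp add: field_simps)
qed (simp add: zero_ereal_def[symmetric] divide_ereal_def)

theorem proposition5p3:
  fixes M :: "'a measure" and A B :: "'a \<Rightarrow> real" and H :: "real \<Rightarrow> real"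
    and \<rho> a :: real and \<gamma> :: ereal and g :: "real \<Rightarrow> ereal"
  assumes "prob_space M"
    and "\<rho> > 0"
    and "regularly_varying_at_0 (- \<rho>) H"
    and "nonneg_rv M A" and "nonneg_rv M B"
    and "IED M \<rho> H \<gamma> B"
    and "positively_quadrant_dependent M A B"
    and "a = ess_inf M A"
  shows "local_dependence_measure M \<rho> H A B g \<longleftrightarrow>
    (\<forall>y\<ge>0. g y = (if ereal y < 1 / ereal a
                   then \<gamma> * ereal ((1 - a * y) powr (- \<rho>))
                   else \<infinity>))"
proof -
  interpret prob_space M by fact
  define G where "G = (\<lambda>y. if ereal y < 1 / ereal a
    then \<gamma> * ereal ((1 - a * y) powr (- \<rho>)) else \<infinity>)"
  have "0 \<le> \<gamma>" using assms(6) by (simp add: IED_def)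
  have a: "0 \<le> a" using ess_inf_nonneg[OF assms(4)] assms(8) by simp
  have lim: "((\<lambda>\<epsilon>. neg_log (\<P>(\<omega> in M. \<epsilon> * A \<omega> * y + B \<omega> < \<epsilon>)) / ereal (H \<epsilon>)) \<longlongrightarrow> G y) (at_right 0)"
    if "0 \<le> y" for y
  proof (cases "a * y < 1")
    case True
    then show ?thesis
      using local_dependence_limit_subcritical[OF assms(2,4,6,7) that] a assms(8)
      by (simp add: G_def ereal_less_inverse_iff)
  next
    case False
    then show ?thesis
      using local_dependence_limit_supercritical[OF assms(4,5,3) that] a assms(8)
      by (simp add: G_def ereal_less_inverse_iff)
  qed
  have G_nonneg: "0 \<le> G y" for y
    using \<open>0 \<le> \<gamma>\<close> by (simp add: G_def)
  have "local_dependence_measure M \<rho> H A B g \<longleftrightarrow> (\<forall>y\<ge>0. g y = G y)"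
  proof
    assume "local_dependence_measure M \<rho> H A B g"
    then have "((\<lambda>\<epsilon>. neg_log (\<P>(\<omega> in M. \<epsilon> * A \<omega> * y + B \<omega> < \<epsilon>)) / ereal (H \<epsilon>)) \<longlongrightarrow> g y) (at_right 0)"
      if "0 \<le> y" for y
      using that by (simp add: local_dependence_measure_def)
    then show "\<forall>y\<ge>0. g y = G y"
      using lim tendsto_unique[OF trivial_limit_at_right_real] by blast
  next
    assume "\<forall>y\<ge>0. g y = G y"
    then show "local_dependence_measure M \<rho> H A B g"
      using lim G_nonneg assms(3-5) by (simp add: local_dependence_measure_def)
  qed
  then show ?thesis by (simp add: G_def)
qed

end
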